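(* Let $f,\hat f\in L^2(\mathcal X,\mu)$ with $\mathbb V_\mu[f]>0$ and $\mathbb V_\mu[\hat f]>0$, and put $$\mathcal E=\frac{\|f-\hat f\|_\mu}{\mathbb V_\mu^{1/2}[f]}.$$ Let $(S_U,\hat S_U)$ denote either the pair of Sobol' indices of $f$ and $\hat f$ for the subset $U$, or (for all $U$ simultaneously) the pair of total-effect indices of $f$ and $\hat f$ for the subset $U$. Then in both cases, for every $U\subseteq\{1,\dots,d\}$, $$|S_U-\hat S_U|\le\Big\{\sqrt{S_U(1-\hat S_U)}+\sqrt{\hat S_U(1-S_U)}\Big\}\cdot\mathcal E,$$ and $$\max_{U\subseteq\{1,\dots,d\}}|S_U-\hat S_U|\le\mathcal E.$$
   Context: $\mathcal X=\mathcal X_1\times\dots\times\mathcal X_d$ with $\mathcal X_i\subseteq\mathbb R$, and $\mu=\mu_1\otimes\dots\otimes\mu_d$ is a product of probability measures $\mu_i$ on $\mathcal X_i$. $L^2(\mathcal X,\mu)$ is the space of real square-integrable functions, with scalar product $\langle g,h\rangle_\mu=\int gh\,d\mu$ and norm $\|g\|_\mu$; $\mathbb E_\mu,\mathbb V_\mu$ are mean and variance under $\mu$. Every $f\in L^2(\mathcal X,\mu)$ has a unique Sobol-Hoeffding decomposition $f(x)=\sum_{U\subseteq\{1,\dots,d\}}f_U(x_U)$, where $f_U$ depends only on $x_U=(x_i)_{i\in U}$, $f_\emptyset=\mathbb E_\mu[f]$, and $\int_{\mathcal X_i}f_U(x_U)\,d\mu_i(x_i)=0$ for every $i\in U$; its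 terms are mutually orthogonal. When $\mathbb V_\mu[f]>0$, the Sobol' index of $U$ is $S_U=\mathbb V_\mu[f_U]/\mathbb V_\mu[f]$ (so $S_\emptyset=0$), and the total-effect index of $U$ is $T_U=\sum_{V:\,V\cap U\ne\emptyset}S_V$ (so $T_\emptyset=0$). Indices of $\hat f$ are denoted with hats. *)

theory Defs
  imports "HOL-Probability.Probability"
begin

definition square_integrable :: "'a measure \<Rightarrow> ('a \<Rightarrow> real) \<Rightarrow> bool" where
  "square_integrable M g \<longleftrightarrow> g \<in> borel_measurable M \<and> integrable M (\<lambda>x. (g x)\<^sup>2)"

definition L2_norm :: "'a measure \<Rightarrow> ('a \<Rightarrow> real) \<Rightarrow> real" where
  "L2_norm M g = sqrt (\<integral>x. (g x)\<^sup>2 \<partial>M)"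

text \<open>
  The term \<open>F U\<close> is a function on the factor indexed by \<open>U\<close>, so that it depends on the
  coordinates in \<open>U\<close> only; the point \<open>x\<close> of the full product is passed to it as
  \<open>restrict x U\<close>. As elements of $L^2$ are classes of functions, the decomposition and the
  vanishing of the partial integrals are required almost everywhere. The partial integrals are
  genuine ones: as \<open>F U\<close> is square-integrable for a probability measure, almost all of its
  sections are integrable, so the default value 0 of a non-existing integral plays no role.
\<close>

definition sobol_hoeffding_decomposition ::
  "nat \<Rightarrow> (nat \<Rightarrow> real measure) \<Rightarrow> ((nat \<Rightarrow> real) \<Rightarrow> real) \<Rightarrow> (nat set \<Rightarrow> (nat \<Rightarrow> real) \<Rightarrow> real) \<Rightarrow> bool"
where
  "sobol_hoeffding_decomposition d \<mu> f F \<longleftrightarrow>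
     (\<forall>U\<subseteq>{1..d}. square_integrable (PiM U \<mu>) (F U)) \<and>
     F {} (\<lambda>_. undefined) = (\<integral>x. f x \<partial>PiM {1..d} \<mu>) \<and>
     (\<forall>U\<subseteq>{1..d}. \<forall>i\<in>U. AE x in PiM U \<mu>. (\<integral>t. F U (x(i := t)) \<partial>\<mu> i) = 0) \<and>
     (AE x in PiM {1..d} \<mu>. f x = (\<Sum>U\<in>Pow {1..d}. F U (restrict x U)))"

text \<open>
  A decomposition exists for every square-integrable \<open>f\<close> on a finite product of probability
  spaces and is unique up to null sets, so the choice below has no influence on the indices.
\<close>

definition sobol_term ::
  "nat \<Rightarrow> (nat \<Rightarrow> real measure) \<Rightarrow> ((nat \<Rightarrow> real) \<Rightarrow> real) \<Rightarrow> nat set \<Rightarrow> (nat \<Rightarrow> real) \<Rightarrow> real"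
where
  "sobol_term d \<mu> f = (SOME F. sobol_hoeffding_decomposition d \<mu> f F)"

definition sobol_index ::
  "nat \<Rightarrow> (nat \<Rightarrow> real measure) \<Rightarrow> ((nat \<Rightarrow> real) \<Rightarrow> real) \<Rightarrow> nat set \<Rightarrow> real"
where
  "sobol_index d \<mu> f U =
     prob_space.variance (PiM {1..d} \<mu>) (\<lambda>x. sobol_term d \<mu> f U (restrict x U)) /
     prob_space.variance (PiM {1..d} \<mu>) f"

definition total_index ::
  "nat \<Rightarrow> (nat \<Rightarrow> real measure) \<Rightarrow> ((nat \<Rightarrow> real) \<Rightarrow> real) \<Rightarrow> nat set \<Rightarrow> real"
where
  "total_index d \<mu> f U = (\<Sum>V | V \<subseteq> {1..d} \<and> V \<inter> U \<noteq> {}. sobol_index d \<mu> f V)"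

end

theory Submission imports Defs begin

text \<open>
  Write \<open>f = \<Sum>U. f\<^sub>U\<close> and \<open>g = \<Sum>U. g\<^sub>U\<close> for the Sobol-Hoeffding decompositions, and
  \<open>p U\<close>, \<open>q U\<close> for the norms of \<open>f\<^sub>U\<close> and \<open>g\<^sub>U\<close>, with \<open>U\<close> nonempty. By
  orthogonality, \<open>p\<close> and \<open>q\<close> are vectors whose squared Euclidean lengths are the variances
  \<open>V\<close> of \<open>f\<close> and \<open>W\<close> of \<open>g\<close>, and since \<open>f - g = \<Sum>U. (f\<^sub>U - g\<^sub>U)\<close> is an orthogonal sum as
  well, the distance of \<open>p\<close> and \<open>q\<close> is at most that of \<open>f\<close> and \<open>g\<close>. A Sobol' index or a
  total-effect index is the share \<open>s\<close> of \<open>V\<close> carried by the coordinates in some family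
  \<open>A\<close> of nonempty sets, and likewise \<open>t\<close> for \<open>W\<close>. This leaves a statement about two vectors
  (lemma \<open>variance_share_diff_le\<close>).

  For that statement, only the lengths \<open>a\<close>, \<open>b\<close> of the parts of \<open>p\<close> inside and outside of \<open>A\<close>,
  and \<open>c\<close>, \<open>d\<close> for \<open>q\<close>, matter. With \<open>s = cos\<^sup>2 \<theta>\<close> and \<open>t = cos\<^sup>2 \<phi>\<close> one has
  \<open>\<bar>s - t\<bar> = \<bar>sin (\<theta> - \<phi>)\<bar> sin (\<theta> + \<phi>)\<close>; the second factor is the sum of square roots in the
  claim and is at most 1, and the first is the distance of the unit vector along \<open>(a, b)\<close>
  from the line spanned by \<open>(c, d)\<close>, hence at most the distance of \<open>(a, b)\<close> from \<open>(c, d)\<close>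
  divided by \<open>sqrt V\<close>.

  The terms of the decomposition are chosen by Hilbert choice, so its existence has to be
  proved. It is obtained by Moebius inversion from the conditional means of \<open>f\<close> given the
  coordinates in \<open>W\<close> (lemma \<open>sobol_hoeffding_decomposition_hoeffding_term\<close>). Uniqueness is not
  needed: any two decompositions, of the same function or of different ones, have mutually
  orthogonal terms for different index sets (lemma \<open>decomposition_terms_orthogonal\<close>). Both the
  vanishing of the partial integrals and the orthogonality rest on the fact that replacing one
  coordinate by an independent copy preserves a product of probability measures (lemma
  \<open>distr_resample\<close>).
\<close>

section \<open>Square-integrable functions\<close>

lemma square_integrableD:
  assumes "square_integrable M g"
  shows "g \<in> borel_measurable M" "integrable M (\<lambda>x. (g x)\<^sup>2)"
  using assms by (auto simp: square_integrable_def)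

lemma square_integrable_imp_integrable_mult:
  assumes "square_integrable M g" "square_integrable M h"
  shows "integrable M (\<lambda>x. g x * h x)"
proof (rule Bochner_Integration.integrable_bound)
  have [measurable]: "g \<in> borel_measurable M" "h \<in> borel_measurable M"
    using assms by (auto simp: square_integrable_def)
  show "integrable M (\<lambda>x. (g x)\<^sup>2 + (h x)\<^sup>2)"
    using assms by (auto simp: square_integrable_def)
  show "(\<lambda>x. g x * h x) \<in> borel_measurable M" by measurable
  have "\<bar>a * b\<bar> \<le> a\<^sup>2 + b\<^sup>2" for a b :: real
    using sum_squares_bound[of "\<bar>a\<bar>" "\<bar>b\<bar>"] abs_ge_zero[of "a * b"]
    unfolding abs_mult power2_abs by linarith
  then show "AE x in M. norm (g x * h x) \<le> norm ((g x)\<^sup>2 + (h x)\<^sup>2)"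
    by simp
qed

lemma square_integrable_add:
  assumes "square_integrable M g" "square_integrable M h"
  shows "square_integrable M (\<lambda>x. g x + h x)"
proof -
  have "integrable M (\<lambda>x. (g x)\<^sup>2 + (h x)\<^sup>2 + 2 * (g x * h x))"
    using assms square_integrable_imp_integrable_mult[OF assms] by (auto simp: square_integrable_def)
  then show ?thesis
    using assms by (auto simp: square_integrable_def power2_sum algebra_simps)
qed

lemma square_integrable_cmult:
  "square_integrable M g \<Longrightarrow> square_integrable M (\<lambda>x. c * g x)" for c :: real
  by (auto simp: square_integrable_def power_mult_distrib)

lemma square_integrable_diff:
  assumes "square_integrable M g" "square_integrable M h"
  shows "square_integrable M (\<lambda>x. g x - h x)"
  using square_integrable_add[OF assms(1) square_integrable_cmult[OF assms(2), of "- 1"]] by simp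

lemma square_integrable_sum:
  assumes "\<And>i. i \<in> A \<Longrightarrow> square_integrable M (g i)"
  shows "square_integrable M (\<lambda>x. \<Sum>i\<in>A. g i x)"
  using assms
  by (induction A rule: infinite_finite_induct)
    (auto intro: square_integrable_add simp: square_integrable_def[of M "\<lambda>_. 0"])

lemma square_integrable_imp_integrable_prob:
  assumes "prob_space M" "square_integrable M g"
  shows "integrable M g"
proof -
  interpret prob_space M by fact
  show ?thesis
    by (rule square_integrable_imp_integrable[OF square_integrableD[OF assms(2)]])
qed

lemma square_integrable_distr:
  assumes T: "T \<in> measurable M N" and d: "distr M N T = N" and g: "square_integrable N g"
  shows "square_integrable M (\<lambda>x. g (T x))"
proof -
  have "integrable (distr M N T) (\<lambda>x. (g x)\<^sup>2)"
    unfolding d by (rule square_integrableD[OF g])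
  from integrable_distr[OF T this] show ?thesis
    unfolding square_integrable_def
    using measurable_compose[OF T square_integrableD(1)[OF g]] by blast
qed

text \<open>
  Jensen's inequality, applied to almost every section of \<open>h\<close>.
\<close>

lemma square_integrable_partial_integral:
  fixes h :: "'a \<times> 'b \<Rightarrow> real"
  assumes "prob_space M" "prob_space N" and h: "square_integrable (M \<Otimes>\<^sub>M N) h"
  shows "square_integrable M (\<lambda>x. \<integral>y. h (x, y) \<partial>N)"
proof -
  interpret M: prob_space M by fact
  interpret N: prob_space N by fact
  interpret P: pair_prob_space M N ..
  have [measurable]: "h \<in> borel_measurable (M \<Otimes>\<^sub>M N)"
    using h by (simp add: square_integrable_def)
  have h2: "integrable (M \<Otimes>\<^sub>M N) (\<lambda>z. (h z)\<^sup>2)"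
    using h by (simp add: square_integrable_def)
  have h1: "integrable (M \<Otimes>\<^sub>M N) h"
    using h by (rule square_integrable_imp_integrable_prob[OF P.prob_space_axioms])
  have "AE x in M. (\<integral>y. h (x, y) \<partial>N)\<^sup>2 \<le> (\<integral>y. (h (x, y))\<^sup>2 \<partial>N)"
    using P.AE_integrable_fst'[OF h1] P.AE_integrable_fst'[OF h2]
  proof eventually_elim
    case (elim x)
    \<comment> \<open>The variance of the section is nonnegative.\<close>
    show ?case
      using N.variance_eq[OF elim] N.variance_positive[of "\<lambda>y. h (x, y)"] by simp
  qed
  then have "integrable M (\<lambda>x. (\<integral>y. h (x, y) \<partial>N)\<^sup>2)"
    by (intro Bochner_Integration.integrable_bound[OF P.integrable_fst'[OF h2]])
      (auto elim!: eventually_mono)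
  then show ?thesis
    by (simp add: square_integrable_def)
qed

lemma Cauchy_Schwarz_integral:
  assumes g: "square_integrable M g" and h: "square_integrable M h"
  shows "(\<integral>x. g x * h x \<partial>M) \<le> L2_norm M g * L2_norm M h"
proof -
  define a b where "a = L2_norm M g" and "b = L2_norm M h"
  have sq: "a\<^sup>2 = (\<integral>x. (g x)\<^sup>2 \<partial>M)" "b\<^sup>2 = (\<integral>x. (h x)\<^sup>2 \<partial>M)"
    by (auto simp: a_def b_def L2_norm_def)
  have nn: "a \<ge> 0" "b \<ge> 0"
    by (auto simp: a_def b_def L2_norm_def)
  have gh: "integrable M (\<lambda>x. g x * h x)"
    by (rule square_integrable_imp_integrable_mult[OF g h])
  note ints = gh square_integrableD[OF g] square_integrableD[OF h]
  show ?thesis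
  proof (cases "a = 0 \<or> b = 0")
    case True
    then have "AE x in M. g x * h x = 0"
    proof
      assume "a = 0"
      then have "AE x in M. (g x)\<^sup>2 = 0"
        using sq integral_nonneg_eq_0_iff_AE[OF ints(3)] by auto
      then show ?thesis by auto
    next
      assume "b = 0"
      then have "AE x in M. (h x)\<^sup>2 = 0"
        using sq integral_nonneg_eq_0_iff_AE[OF ints(5)] by auto
      then show ?thesis by auto
    qed
    then have "(\<integral>x. g x * h x \<partial>M) = 0"
      by (rule integral_eq_zero_AE)
    then show ?thesis using nn by (simp add: a_def b_def)
  next
    case False
    have "0 \<le> (\<integral>x. (b * g x - a * h x)\<^sup>2 \<partial>M)" by simp
    also have "(\<lambda>x. (b * g x - a * h x)\<^sup>2) =
        (\<lambda>x. b\<^sup>2 * (g x)\<^sup>2 + a\<^sup>2 * (h x)\<^sup>2 - (2 * a * b) * (g x * h x))"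
      by (auto simp: power2_eq_square algebra_simps)
    also have "(\<integral>x. b\<^sup>2 * (g x)\<^sup>2 + a\<^sup>2 * (h x)\<^sup>2 - (2 * a * b) * (g x * h x) \<partial>M)
        = b\<^sup>2 * a\<^sup>2 + a\<^sup>2 * b\<^sup>2 - (2 * a * b) * (\<integral>x. g x * h x \<partial>M)"
      using ints by (simp add: sq)
    finally have "(2 * a * b) * (\<integral>x. g x * h x \<partial>M) \<le> (2 * a * b) * (a * b)"
      by (simp add: power2_eq_square algebra_simps)
    moreover have "2 * a * b > 0" using False nn by auto
    ultimately have "(\<integral>x. g x * h x \<partial>M) \<le> a * b" by (simp only: mult_le_cancel_left_pos)
    then show ?thesis by (simp add: a_def b_def)
  qed
qed

lemma L2_norm_diff_le:
  assumes g: "square_integrable M g" and h: "square_integrable M h"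
  shows "(L2_norm M g - L2_norm M h)\<^sup>2 \<le> (\<integral>x. (g x - h x)\<^sup>2 \<partial>M)"
proof -
  have sq: "(L2_norm M k)\<^sup>2 = (\<integral>x. (k x)\<^sup>2 \<partial>M)" for k by (simp add: L2_norm_def)
  have "(\<integral>x. (g x - h x)\<^sup>2 \<partial>M) = (\<integral>x. (g x)\<^sup>2 + (h x)\<^sup>2 - 2 * (g x * h x) \<partial>M)"
    by (simp add: power2_diff algebra_simps)
  also have "\<dots> = (L2_norm M g)\<^sup>2 + (L2_norm M h)\<^sup>2 - 2 * (\<integral>x. g x * h x \<partial>M)"
    using square_integrableD[OF g] square_integrableD[OF h]
      square_integrable_imp_integrable_mult[OF g h] by (simp add: sq)
  finally show ?thesis
    using Cauchy_Schwarz_integral[OF g h] by (simp add: power2_diff)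
qed

text \<open>
  Pythagoras' theorem for finitely many orthogonal functions.
\<close>

lemma integral_square_sum_orthogonal:
  assumes "finite A" and sq: "\<And>i. i \<in> A \<Longrightarrow> square_integrable M (g i)"
    and orth: "\<And>i j. i \<in> A \<Longrightarrow> j \<in> A \<Longrightarrow> i \<noteq> j \<Longrightarrow> (\<integral>x. g i x * g j x \<partial>M) = 0"
  shows "(\<integral>x. (\<Sum>i\<in>A. g i x)\<^sup>2 \<partial>M) = (\<Sum>i\<in>A. \<integral>x. (g i x)\<^sup>2 \<partial>M)"
proof -
  have int: "integrable M (\<lambda>x. g i x * g j x)" if "i \<in> A" "j \<in> A" for i j
    using that sq by (intro square_integrable_imp_integrable_mult) auto
  have "(\<integral>x. (\<Sum>i\<in>A. g i x)\<^sup>2 \<partial>M) = (\<integral>x. (\<Sum>i\<in>A. \<Sum>j\<in>A. g i x * g j x) \<partial>M)"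
    by (simp add: power2_eq_square sum_product)
  also have "\<dots> = (\<Sum>i\<in>A. \<Sum>j\<in>A. \<integral>x. g i x * g j x \<partial>M)"
    using int by (simp add: Bochner_Integration.integral_sum Bochner_Integration.integrable_sum)
  also have "\<dots> = (\<Sum>i\<in>A. \<Sum>j\<in>A. if j = i then \<integral>x. (g i x)\<^sup>2 \<partial>M else 0)"
    using orth by (intro sum.cong refl) (auto simp: power2_eq_square)
  also have "\<dots> = (\<Sum>i\<in>A. \<integral>x. (g i x)\<^sup>2 \<partial>M)"
    using \<open>finite A\<close> by simp
  finally show ?thesis .
qed

section \<open>Shares of the squared length of two vectors\<close>

text \<open>
  The vectors \<open>p\<close> and \<open>q\<close> have squared lengths \<open>V\<close> and \<open>W\<close>, of which \<open>s\<close> and \<open>t\<close> are the shares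
  of the coordinates in \<open>A\<close>.
\<close>

lemma variance_share_diff_le:
  fixes p q :: "'a \<Rightarrow> real"
  assumes N: "finite N" "A \<subseteq> N"
    and V: "V = (\<Sum>i\<in>N. (p i)\<^sup>2)" "V > 0" and W: "W = (\<Sum>i\<in>N. (q i)\<^sup>2)" "W > 0"
    and e: "(\<Sum>i\<in>N. (p i - q i)\<^sup>2) \<le> e\<^sup>2 * V" "e \<ge> 0"
    and s: "s = (\<Sum>i\<in>A. (p i)\<^sup>2) / V" and t: "t = (\<Sum>i\<in>A. (q i)\<^sup>2) / W"
  shows "\<bar>s - t\<bar> \<le> (sqrt (s * (1 - t)) + sqrt (t * (1 - s))) * e" "\<bar>s - t\<bar> \<le> e"
proof -
  define a b where "a = L2_set p A" and "b = L2_set p (N - A)"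
  define c d where "c = L2_set q A" and "d = L2_set q (N - A)"
  define v w where "v = sqrt V" and "w = sqrt W"
  have nn: "a \<ge> 0" "b \<ge> 0" "c \<ge> 0" "d \<ge> 0" "v > 0" "w > 0"
    using V(2) W(2) by (auto simp: a_def b_def c_def d_def v_def w_def)
  have sqL: "(L2_set r B)\<^sup>2 = (\<Sum>i\<in>B. (r i)\<^sup>2)" for r :: "'a \<Rightarrow> real" and B
    by (simp add: L2_set_def sum_nonneg)
  have split: "(\<Sum>i\<in>N. r i) = (\<Sum>i\<in>A. r i) + (\<Sum>i\<in>N - A. r i)" for r :: "'a \<Rightarrow> real"
    using sum.subset_diff[OF N(2,1), of r] by simp
  have v2: "v\<^sup>2 = a\<^sup>2 + b\<^sup>2" "V = v\<^sup>2" and w2: "w\<^sup>2 = c\<^sup>2 + d\<^sup>2" "W = w\<^sup>2"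
    using V W by (auto simp: v_def w_def a_def b_def c_def d_def sqL split)
  have tri: "(L2_set p B - L2_set q B)\<^sup>2 \<le> (\<Sum>i\<in>B. (p i - q i)\<^sup>2)" for B
  proof -
    have "L2_set p B \<le> L2_set (\<lambda>i. p i - q i) B + L2_set q B"
      using L2_set_triangle_ineq[of "\<lambda>i. p i - q i" q B] by simp
    moreover have "L2_set q B \<le> L2_set (\<lambda>i. p i - q i) B + L2_set p B"
      using L2_set_triangle_ineq[of "\<lambda>i. q i - p i" p B]
      by (simp add: L2_set_def power2_commute)
    ultimately have "\<bar>L2_set p B - L2_set q B\<bar> \<le> L2_set (\<lambda>i. p i - q i) B" by linarith
    then have "\<bar>L2_set p B - L2_set q B\<bar>\<^sup>2 \<le> (L2_set (\<lambda>i. p i - q i) B)\<^sup>2"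
      by (intro power_mono) auto
    then show ?thesis by (simp add: sqL)
  qed
  have dist: "(a - c)\<^sup>2 + (b - d)\<^sup>2 \<le> (e * v)\<^sup>2"
    using tri[of A] tri[of "N - A"] e(1) v2
    by (simp add: a_def b_def c_def d_def split power_mult_distrib)
  \<comment> \<open>Lagrange's identity for \<open>(a - c, b - d)\<close> and \<open>(c, d)\<close>, as \<open>(a - c) d - (b - d) c = a d - c b\<close>.\<close>
  have "(a * d - c * b)\<^sup>2 + ((a - c) * c + (b - d) * d)\<^sup>2 = ((a - c)\<^sup>2 + (b - d)\<^sup>2) * w\<^sup>2"
    unfolding w2 by algebra
  then have "(a * d - c * b)\<^sup>2 \<le> ((a - c)\<^sup>2 + (b - d)\<^sup>2) * w\<^sup>2"
    using zero_le_power2[of "(a - c) * c + (b - d) * d"] by linarith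
  also have "\<dots> \<le> (e * v)\<^sup>2 * w\<^sup>2"
    using dist by (intro mult_right_mono) auto
  finally have "\<bar>a * d - c * b\<bar>\<^sup>2 \<le> (e * v * w)\<^sup>2"
    by (simp add: power_mult_distrib)
  then have sin: "\<bar>a * d - c * b\<bar> \<le> e * v * w"
    by (rule power2_le_imp_le) (use nn e in auto)
  have st: "s = a\<^sup>2 / v\<^sup>2" "t = c\<^sup>2 / w\<^sup>2"
    using s t v2 w2 by (auto simp: a_def c_def sqL)
  have st1: "1 - s = b\<^sup>2 / v\<^sup>2" "1 - t = d\<^sup>2 / w\<^sup>2"
  proof -
    have "1 - s = (v\<^sup>2 - a\<^sup>2) / v\<^sup>2" "1 - t = (w\<^sup>2 - c\<^sup>2) / w\<^sup>2"
      using nn by (simp_all add: st diff_divide_distrib)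
    then show "1 - s = b\<^sup>2 / v\<^sup>2" "1 - t = d\<^sup>2 / w\<^sup>2"
      by (simp_all add: v2(1) w2(1))
  qed
  have roots: "sqrt (s * (1 - t)) = a * d / (v * w)" "sqrt (t * (1 - s)) = c * b / (v * w)"
    unfolding st1 unfolding st using nn by (auto simp: real_sqrt_mult real_sqrt_divide)
  have "s - t = (a * d - c * b) / (v * w) * ((a * d + c * b) / (v * w))"
  proof -
    have "s - t = s * (1 - t) - t * (1 - s)" by (simp add: algebra_simps)
    also have "\<dots> = (a * d - c * b) / (v * w) * ((a * d + c * b) / (v * w))"
      unfolding st1 unfolding st using nn by (simp add: field_simps power2_eq_square)
    finally show ?thesis .
  qed
  then have "\<bar>s - t\<bar> = \<bar>a * d - c * b\<bar> / (v * w) * ((a * d + c * b) / (v * w))"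
    using nn by (simp add: abs_mult abs_of_nonneg)
  also have "\<dots> \<le> e * ((a * d + c * b) / (v * w))"
    using sin nn by (intro mult_right_mono) (auto simp: field_simps)
  finally show main: "\<bar>s - t\<bar> \<le> (sqrt (s * (1 - t)) + sqrt (t * (1 - s))) * e"
    by (simp add: roots add_divide_distrib mult.commute)
  \<comment> \<open>The arithmetic-geometric mean inequality for each root; the two means add up to 1.\<close>
  have "sqrt (s * (1 - t)) + sqrt (t * (1 - s)) \<le> (s + (1 - t)) / 2 + (t + (1 - s)) / 2"
    using st st1 nn by (intro add_mono arith_geo_mean_sqrt) auto
  then have "(sqrt (s * (1 - t)) + sqrt (t * (1 - s))) * e \<le> 1 * e"
    using e(2) by (intro mult_right_mono) (auto simp: field_simps)
  then show "\<bar>s - t\<bar> \<le> e"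
    using main by simp
qed

section \<open>Resampling coordinates of a product probability space\<close>

text \<open>
  Replacing the coordinate \<open>i\<close> by an independent copy preserves the product measure.
\<close>

lemma (in finite_product_prob_space) distr_resample:
  assumes "i \<in> I"
  shows "distr (PiM I M \<Otimes>\<^sub>M M i) (PiM I M) (\<lambda>(y, t). y(i := t)) = PiM I M"
proof (rule PiM_eqI[OF finite_index])
  show "sets (distr (PiM I M \<Otimes>\<^sub>M M i) (PiM I M) (\<lambda>(y, t). y(i := t))) = sets (PiM I M)"
    by simp
next
  fix A assume A: "\<And>j. j \<in> I \<Longrightarrow> A j \<in> sets (M j)"
  let ?B = "A(i := space (M i))"
  have T: "(\<lambda>(y, t). y(i := t)) \<in> measurable (PiM I M \<Otimes>\<^sub>M M i) (PiM I M)"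
    using measurable_add_dim[of i I M] assms by (simp add: insert_absorb)
  have Asp: "A j \<subseteq> space (M j)" if "j \<in> I" for j
    using A[OF that] by (rule sets.sets_into_space)
  have "(\<lambda>(y, t). y(i := t)) -` Pi\<^sub>E I A \<inter> space (PiM I M \<Otimes>\<^sub>M M i) = Pi\<^sub>E I ?B \<times> A i"
    using assms Asp
    by (auto simp: space_pair_measure space_PiM PiE_iff extensional_def split: if_splits) blast+
  then have "emeasure (distr (PiM I M \<Otimes>\<^sub>M M i) (PiM I M) (\<lambda>(y, t). y(i := t))) (Pi\<^sub>E I A)
      = emeasure (PiM I M \<Otimes>\<^sub>M M i) (Pi\<^sub>E I ?B \<times> A i)"
    using A finite_index by (subst emeasure_distr[OF T]) (auto intro!: sets_PiM_I_finite)
  also have "\<dots> = emeasure (PiM I M) (Pi\<^sub>E I ?B) * emeasure (M i) (A i)"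
    using A assms finite_index
    by (intro M.emeasure_pair_measure_Times sets_PiM_I_finite) auto
  also have "emeasure (PiM I M) (Pi\<^sub>E I ?B) = (\<Prod>j\<in>I. emeasure (M j) (?B j))"
    using A by (intro measure_times) auto
  also have "\<dots> = emeasure (M i) (space (M i)) * (\<Prod>j\<in>I - {i}. emeasure (M j) (A j))"
    using assms finite_index by (subst prod.remove[of _ i]) auto
  also have "\<dots> * emeasure (M i) (A i) = (\<Prod>j\<in>I. emeasure (M j) (A j))"
    using assms finite_index by (simp add: M.emeasure_space_1 prod.remove[of I i] mult.commute)
  finally show "emeasure (distr (PiM I M \<Otimes>\<^sub>M M i) (PiM I M) (\<lambda>(y, t). y(i := t))) (Pi\<^sub>E I A)
      = (\<Prod>j\<in>I. emeasure (M j) (A j))" .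
qed

text \<open>
  The point over \<open>I\<close> that agrees with \<open>z\<close> on \<open>W\<close> and with \<open>y\<close> elsewhere. Here \<open>y\<close> ranges over
  the full product instead of the factor \<open>I - W\<close>; the coordinates of \<open>y\<close> in \<open>W\<close> are ignored.
  Thus the space of \<open>y\<close> does not change with \<open>W\<close>.
\<close>

definition hybrid :: "'a set \<Rightarrow> 'a set \<Rightarrow> ('a \<Rightarrow> 'b) \<Rightarrow> ('a \<Rightarrow> 'b) \<Rightarrow> 'a \<Rightarrow> 'b" where
  "hybrid I W z y = (\<lambda>j\<in>I. if j \<in> W then z j else y j)"

lemma measurable_hybrid:
  assumes "W \<subseteq> I"
  shows "(\<lambda>(z, y). hybrid I W z y) \<in> measurable (PiM W M \<Otimes>\<^sub>M PiM I M) (PiM I M)"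
proof -
  have "(\<lambda>p. if j \<in> W then fst p j else snd p j) \<in> measurable (PiM W M \<Otimes>\<^sub>M PiM I M) (M j)"
    if "j \<in> I" for j
    using that by (cases "j \<in> W") auto
  then show ?thesis
    unfolding hybrid_def case_prod_beta by (intro measurable_restrict) auto
qed

lemma (in finite_product_prob_space) distr_hybrid:
  assumes W: "W \<subseteq> I"
  shows "distr (PiM W M \<Otimes>\<^sub>M PiM I M) (PiM I M) (\<lambda>(z, y). hybrid I W z y) = PiM I M"
proof (rule PiM_eqI[OF finite_index])
  show "sets (distr (PiM W M \<Otimes>\<^sub>M PiM I M) (PiM I M) (\<lambda>(z, y). hybrid I W z y)) = sets (PiM I M)"
    by simp
next
  fix A assume A: "\<And>j. j \<in> I \<Longrightarrow> A j \<in> sets (M j)"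
  let ?B = "\<lambda>j. if j \<in> W then space (M j) else A j"
  have fin: "finite W" using W finite_index by (rule finite_subset)
  interpret W: finite_product_prob_space M W by unfold_locales (fact fin)
  have Asp: "A j \<subseteq> space (M j)" if "j \<in> I" for j
    using A[OF that] by (rule sets.sets_into_space)
  have "(\<lambda>(z, y). hybrid I W z y) -` Pi\<^sub>E I A \<inter> space (PiM W M \<Otimes>\<^sub>M PiM I M)
      = Pi\<^sub>E W A \<times> Pi\<^sub>E I ?B"
  proof (rule set_eqI, rule prod.induct)
    fix z y
    have "hybrid I W z y \<in> Pi\<^sub>E I A \<longleftrightarrow> (\<forall>j\<in>W. z j \<in> A j) \<and> (\<forall>j\<in>I - W. y j \<in> A j)"
      using W by (auto simp: hybrid_def PiE_iff)
    moreover have "z \<in> Pi\<^sub>E W A \<longleftrightarrow> z \<in> (\<Pi>\<^sub>E j\<in>W. space (M j)) \<and> (\<forall>j\<in>W. z j \<in> A j)"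
      using W Asp by (auto simp: PiE_iff)
    moreover have "y \<in> Pi\<^sub>E I ?B \<longleftrightarrow> y \<in> (\<Pi>\<^sub>E j\<in>I. space (M j)) \<and> (\<forall>j\<in>I - W. y j \<in> A j)"
      using W Asp by (auto simp: PiE_iff split: if_splits)
    ultimately show "(z, y) \<in> (\<lambda>(z, y). hybrid I W z y) -` Pi\<^sub>E I A \<inter> space (PiM W M \<Otimes>\<^sub>M PiM I M)
        \<longleftrightarrow> (z, y) \<in> Pi\<^sub>E W A \<times> Pi\<^sub>E I ?B"
      by (simp add: space_pair_measure space_PiM) blast
  qed
  then have "emeasure (distr (PiM W M \<Otimes>\<^sub>M PiM I M) (PiM I M) (\<lambda>(z, y). hybrid I W z y)) (Pi\<^sub>E I A)
      = emeasure (PiM W M \<Otimes>\<^sub>M PiM I M) (Pi\<^sub>E W A \<times> Pi\<^sub>E I ?B)"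
    using A finite_index
    by (subst emeasure_distr[OF measurable_hybrid[OF W]]) (auto intro!: sets_PiM_I_finite)
  also have "\<dots> = emeasure (PiM W M) (Pi\<^sub>E W A) * emeasure (PiM I M) (Pi\<^sub>E I ?B)"
    using A W finite_index fin by (intro emeasure_pair_measure_Times sets_PiM_I_finite) auto
  also have "emeasure (PiM W M) (Pi\<^sub>E W A) = (\<Prod>j\<in>W. emeasure (M j) (A j))"
    using A W by (intro W.measure_times) auto
  also have "emeasure (PiM I M) (Pi\<^sub>E I ?B) = (\<Prod>j\<in>I. emeasure (M j) (?B j))"
    using A by (intro measure_times) auto
  also have "\<dots> = (\<Prod>j\<in>I - W. emeasure (M j) (A j))"
    using finite_index W
    by (intro prod.mono_neutral_cong_right) (auto simp: M.emeasure_space_1)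
  also have "(\<Prod>j\<in>W. emeasure (M j) (A j)) * (\<Prod>j\<in>I - W. emeasure (M j) (A j))
      = (\<Prod>j\<in>I. emeasure (M j) (A j))"
    using prod.subset_diff[OF W finite_index, of "\<lambda>j. emeasure (M j) (A j)"]
    by (simp add: mult.commute)
  finally show "emeasure (distr (PiM W M \<Otimes>\<^sub>M PiM I M) (PiM I M) (\<lambda>(z, y). hybrid I W z y)) (Pi\<^sub>E I A)
      = (\<Prod>j\<in>I. emeasure (M j) (A j))" .
qed

text \<open>
  Fubini's theorem for the resampled coordinate, in both orders of integration.
\<close>

lemma (in finite_product_prob_space) resample_Fubini:
  fixes k :: "('a \<Rightarrow> 'b) \<Rightarrow> real"
  assumes i: "i \<in> I" and k: "integrable (PiM I M) k"
  shows "integrable (M i) (\<lambda>t. \<integral>y. k (y(i := t)) \<partial>PiM I M)"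
    and "(\<integral>t. (\<integral>y. k (y(i := t)) \<partial>PiM I M) \<partial>M i) = (\<integral>y. k y \<partial>PiM I M)"
    and "(\<integral>y. (\<integral>t. k (y(i := t)) \<partial>M i) \<partial>PiM I M) = (\<integral>y. k y \<partial>PiM I M)"
proof -
  interpret P: pair_prob_space "PiM I M" "M i" ..
  have T: "(\<lambda>(y, t). y(i := t)) \<in> measurable (PiM I M \<Otimes>\<^sub>M M i) (PiM I M)"
    using measurable_add_dim[of i I M] i by (simp add: insert_absorb)
  have km: "k \<in> borel_measurable (PiM I M)" using k by simp
  have "integrable (distr (PiM I M \<Otimes>\<^sub>M M i) (PiM I M) (\<lambda>(y, t). y(i := t))) k"
    using k by (simp only: distr_resample[OF i])
  from integrable_distr[OF T this]
  have int: "integrable (PiM I M \<Otimes>\<^sub>M M i) (\<lambda>(y, t). k (y(i := t)))"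
    by (simp add: split_beta')
  have "(\<integral>y. k y \<partial>PiM I M)
      = (\<integral>y. k y \<partial>distr (PiM I M \<Otimes>\<^sub>M M i) (PiM I M) (\<lambda>(y, t). y(i := t)))"
    by (simp only: distr_resample[OF i])
  also have "\<dots> = (\<integral>(y, t). k (y(i := t)) \<partial>(PiM I M \<Otimes>\<^sub>M M i))"
    by (subst integral_distr[OF T km]) (simp add: split_beta')
  finally have eq: "(\<integral>y. k y \<partial>PiM I M) = (\<integral>(y, t). k (y(i := t)) \<partial>(PiM I M \<Otimes>\<^sub>M M i))" .
  show "integrable (M i) (\<lambda>t. \<integral>y. k (y(i := t)) \<partial>PiM I M)"
    by (rule P.integrable_snd[OF int])
  show "(\<integral>t. (\<integral>y. k (y(i := t)) \<partial>PiM I M) \<partial>M i) = (\<integral>y. k y \<partial>PiM I M)"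
    unfolding eq by (rule P.integral_snd[OF int])
  show "(\<integral>y. (\<integral>t. k (y(i := t)) \<partial>M i) \<partial>PiM I M) = (\<integral>y. k y \<partial>PiM I M)"
    unfolding eq by (rule P.integral_fst[OF int])
qed

section \<open>Functions of a subset of the coordinates\<close>

lemma (in finite_product_prob_space) distr_restrict_subset:
  "W \<subseteq> U \<Longrightarrow> U \<subseteq> I \<Longrightarrow> distr (PiM U M) (PiM W M) (\<lambda>x. restrict x W) = PiM W M"
  by (metis distr_restrict finite_subset finite_index)

lemma (in finite_product_prob_space) square_integrable_restrict:
  assumes "W \<subseteq> U" "U \<subseteq> I" "square_integrable (PiM W M) a"
  shows "square_integrable (PiM U M) (\<lambda>x. a (restrict x W))"
  using assms by (intro square_integrable_distr[OF measurable_restrict_subset distr_restrict_subset])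

lemma (in finite_product_prob_space) AE_restrict:
  assumes "W \<subseteq> U" "U \<subseteq> I" "AE z in PiM W M. Q z"
  shows "AE x in PiM U M. Q (restrict x W)"
proof -
  have "AE z in distr (PiM U M) (PiM W M) (\<lambda>x. restrict x W). Q z"
    using assms(3) by (simp only: distr_restrict_subset[OF assms(1,2)])
  then show ?thesis
    by (rule AE_distrD[OF measurable_restrict_subset[OF assms(1)]])
qed

text \<open>
  Orthogonality: if \<open>a\<close> has mean zero in a coordinate on which \<open>b\<close> does not depend, then
  integrating over this coordinate first annihilates the product.
\<close>

lemma (in finite_product_prob_space) integral_mult_terms_eq_0:
  assumes U: "U \<subseteq> I" and V: "V \<subseteq> I" and i: "i \<in> U" "i \<notin> V"
    and a: "square_integrable (PiM U M) a" and b: "square_integrable (PiM V M) b"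
    and van: "AE x in PiM U M. (\<integral>t. a (x(i := t)) \<partial>M i) = 0"
  shows "(\<integral>x. a (restrict x U) * b (restrict x V) \<partial>PiM I M) = 0"
proof -
  let ?k = "\<lambda>x. a (restrict x U) * b (restrict x V)"
  have iI: "i \<in> I" using U i by auto
  have k: "integrable (PiM I M) ?k"
    using square_integrable_restrict[OF U order_refl a] square_integrable_restrict[OF V order_refl b]
    by (rule square_integrable_imp_integrable_mult)
  have "AE x in PiM I M. (\<integral>t. ?k (x(i := t)) \<partial>M i) = 0"
    using AE_restrict[OF U order_refl van]
  proof eventually_elim
    case (elim x)
    have "restrict (x(i := t)) U = (restrict x U)(i := t)" "restrict (x(i := t)) V = restrict x V" for t
      using i by (auto simp: restrict_def)
    then show ?case using elim by simp
  qed
  then have "(\<integral>x. (\<integral>t. ?k (x(i := t)) \<partial>M i) \<partial>PiM I M) = 0"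
    by (rule integral_eq_zero_AE)
  then show ?thesis by (simp only: resample_Fubini(3)[OF iI k])
qed

section \<open>Existence of the decomposition\<close>

text \<open>
  The conditional mean of \<open>f\<close> given that the coordinates in \<open>W\<close> are those of \<open>z\<close>. Where the
  section of \<open>f\<close> is not integrable, the value is the default 0 of the integral; for
  square-integrable \<open>f\<close> and \<open>W \<subseteq> I\<close> this happens on a null set only.
\<close>

definition (in finite_product_prob_space) marginal :: "(('a \<Rightarrow> 'b) \<Rightarrow> real) \<Rightarrow> 'a set \<Rightarrow> ('a \<Rightarrow> 'b) \<Rightarrow> real" where
  "marginal f W z = (\<integral>y. f (hybrid I W z y) \<partial>PiM I M)"

lemma (in finite_product_prob_space) square_integrable_hybrid:
  assumes W: "W \<subseteq> I" and f: "square_integrable (PiM I M) f"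
  shows "square_integrable (PiM W M \<Otimes>\<^sub>M PiM I M) (\<lambda>p. f (hybrid I W (fst p) (snd p)))"
  using square_integrable_distr[OF measurable_hybrid[OF W] distr_hybrid[OF W] f]
  by (simp add: case_prod_beta)

lemma (in finite_product_prob_space) square_integrable_marginal:
  assumes W: "W \<subseteq> I" and f: "square_integrable (PiM I M) f"
  shows "square_integrable (PiM W M) (marginal f W)"
proof -
  have "prob_space (PiM W M)" by (rule prob_space_PiM) (rule M.prob_space_axioms)
  from square_integrable_partial_integral[OF this prob_space_axioms square_integrable_hybrid[OF W f]]
  show ?thesis by (simp add: marginal_def[abs_def])
qed

text \<open>
  The tower property for one coordinate: averaging out \<open>i\<close> turns the conditional mean given
  \<open>insert i W\<close> into the one given \<open>W\<close>.
\<close>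

lemma (in finite_product_prob_space) integral_marginal_insert:
  assumes W: "W \<subseteq> U" and U: "U \<subseteq> I" and i: "i \<in> I" "i \<notin> W"
    and f: "square_integrable (PiM I M) f"
  shows "AE x in PiM U M.
    integrable (M i) (\<lambda>t. marginal f (insert i W) (restrict (x(i := t)) (insert i W))) \<and>
    (\<integral>t. marginal f (insert i W) (restrict (x(i := t)) (insert i W)) \<partial>M i)
      = marginal f W (restrict x W)"
proof -
  have WI: "W \<subseteq> I" using W U by auto
  have "prob_space (PiM W M)" by (rule prob_space_PiM) (rule M.prob_space_axioms)
  then interpret W: prob_space "PiM W M" .
  interpret P: pair_prob_space "PiM W M" "PiM I M" ..
  have "integrable (PiM W M \<Otimes>\<^sub>M PiM I M) (\<lambda>p. f (hybrid I W (fst p) (snd p)))"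
    by (rule square_integrable_imp_integrable_prob[OF P.prob_space_axioms square_integrable_hybrid[OF WI f]])
  from P.AE_integrable_fst'[OF this]
  have "AE z in PiM W M. integrable (PiM I M) (\<lambda>y. f (hybrid I W z y))"
    by simp
  from AE_restrict[OF W U this] show ?thesis
  proof eventually_elim
    case (elim x)
    \<comment> \<open>The coordinate \<open>i\<close> set to \<open>t\<close> may be attributed to the averaged point \<open>y\<close>.\<close>
    have "hybrid I (insert i W) (restrict (x(i := t)) (insert i W)) y
        = hybrid I W (restrict x W) (y(i := t))" for t y
      using i by (auto simp: hybrid_def fun_eq_iff)
    then have "marginal f (insert i W) (restrict (x(i := t)) (insert i W))
        = (\<integral>y. f (hybrid I W (restrict x W) (y(i := t))) \<partial>PiM I M)" for t
      by (simp add: marginal_def)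
    then show ?case
      using resample_Fubini(1,2)[OF i(1) elim] by (simp add: marginal_def)
  qed
qed

text \<open>
  The Moebius inverse of the conditional means. The two signs multiply to the usual
  $(-1)^{|U \setminus W|}$.
\<close>

definition (in finite_product_prob_space) hoeffding_term ::
    "(('a \<Rightarrow> 'b) \<Rightarrow> real) \<Rightarrow> 'a set \<Rightarrow> ('a \<Rightarrow> 'b) \<Rightarrow> real" where
  "hoeffding_term f U x =
     (-1) ^ card U * (\<Sum>W\<in>Pow U. (-1) ^ card W * marginal f W (restrict x W))"

lemma (in finite_product_prob_space) square_integrable_hoeffding_term:
  assumes U: "U \<subseteq> I" and f: "square_integrable (PiM I M) f"
  shows "square_integrable (PiM U M) (hoeffding_term f U)"
  unfolding hoeffding_term_def[abs_def]
  using U by (intro square_integrable_cmult square_integrable_sum square_integrable_restrict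
      square_integrable_marginal f) auto

lemma (in finite_product_prob_space) hoeffding_term_empty:
  "hoeffding_term f {} x = (\<integral>y. f y \<partial>PiM I M)"
proof -
  have "f (hybrid I {} z y) = f y" if "y \<in> space (PiM I M)" for y z
    using that by (simp add: hybrid_def space_PiM PiE_restrict)
  then show ?thesis
    by (simp add: hoeffding_term_def marginal_def cong: Bochner_Integration.integral_cong)
qed

lemma (in finite_product_prob_space) sum_hoeffding_term:
  assumes x: "x \<in> space (PiM I M)"
  shows "(\<Sum>U\<in>Pow I. hoeffding_term f U (restrict x U)) = f x"
proof -
  define g where "g = (\<lambda>S. \<Sum>W\<in>Pow S. (-1) ^ card W * marginal f W (restrict x W))"
  have "hoeffding_term f U (restrict x U) = (-1) ^ card U * g U" for U
  proof -
    have "restrict (restrict x U) W = restrict x W" if "W \<in> Pow U" for W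
      using that by (auto simp: Int_absorb1)
    then show ?thesis
      by (simp add: hoeffding_term_def g_def)
  qed
  then have "(\<Sum>U\<in>Pow I. hoeffding_term f U (restrict x U)) = (\<Sum>U\<in>Pow I. (-1) ^ card U * g U)"
    by simp
  also have "\<dots> = marginal f I (restrict x I)"
    using inclusion_exclusion_symmetric[of g "\<lambda>W. marginal f W (restrict x W)", OF _ finite_index]
    by (simp add: g_def)
  also have "\<dots> = f x"
  proof -
    have "hybrid I I (restrict x I) y = x" for y
      using x by (auto simp: hybrid_def space_PiM fun_eq_iff PiE_iff extensional_def)
    then show ?thesis by (simp add: marginal_def P.prob_space)
  qed
  finally show ?thesis .
qed

text \<open>
  The subsets of \<open>U\<close> come in pairs \<open>W\<close>, \<open>insert i W\<close> with opposite signs, and by the tower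
  property the conditional means of each pair cancel after integration over coordinate \<open>i\<close>.
\<close>

lemma (in finite_product_prob_space) integral_hoeffding_term:
  assumes U: "U \<subseteq> I" and i: "i \<in> U" and f: "square_integrable (PiM I M) f"
  shows "AE x in PiM U M. (\<integral>t. hoeffding_term f U (x(i := t)) \<partial>M i) = 0"
proof -
  have fin: "finite U" using U finite_index by (rule finite_subset)
  have "AE x in PiM U M. \<forall>W\<in>Pow (U - {i}).
      integrable (M i) (\<lambda>t. marginal f (insert i W) (restrict (x(i := t)) (insert i W))) \<and>
      (\<integral>t. marginal f (insert i W) (restrict (x(i := t)) (insert i W)) \<partial>M i)
        = marginal f W (restrict x W)"
    using fin U i by (intro AE_finite_allI integral_marginal_insert f) auto
  then show ?thesis
  proof eventually_elim
    case (elim x)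
    let ?m = "\<lambda>W t. marginal f W (restrict (x(i := t)) W)"
    have split: "(\<Sum>W\<in>Pow U. (-1) ^ card W * ?m W t)
        = (\<Sum>W\<in>Pow (U - {i}). (-1) ^ card W * (marginal f W (restrict x W) - ?m (insert i W) t))" for t
    proof -
      have "U = insert i (U - {i})" using i by auto
      then have "Pow U = Pow (U - {i}) \<union> insert i ` Pow (U - {i})"
        by (metis Pow_insert)
      moreover have "inj_on (insert i) (Pow (U - {i}))"
        by (auto simp: inj_on_def)
      moreover have "Pow (U - {i}) \<inter> insert i ` Pow (U - {i}) = {}" by auto
      ultimately have "(\<Sum>W\<in>Pow U. (-1) ^ card W * ?m W t)
          = (\<Sum>W\<in>Pow (U - {i}). (-1) ^ card W * ?m W t)
            + (\<Sum>W\<in>Pow (U - {i}). (-1) ^ card (insert i W) * ?m (insert i W) t)"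
        using fin by (simp add: sum.union_disjoint sum.reindex)
      also have "\<dots> = (\<Sum>W\<in>Pow (U - {i}). (-1) ^ card W * ?m W t + (-1) ^ card (insert i W) * ?m (insert i W) t)"
        by (simp add: sum.distrib)
      also have "\<dots> = (\<Sum>W\<in>Pow (U - {i}). (-1) ^ card W * (marginal f W (restrict x W) - ?m (insert i W) t))"
      proof (intro sum.cong refl)
        fix W assume W: "W \<in> Pow (U - {i})"
        then have "i \<notin> W" "finite W" using fin finite_subset by auto
        moreover from this have "restrict (x(i := t)) W = restrict x W" by (auto simp: restrict_def)
        ultimately show "(-1) ^ card W * ?m W t + (-1) ^ card (insert i W) * ?m (insert i W) t
            = (-1) ^ card W * (marginal f W (restrict x W) - ?m (insert i W) t)"
          by (simp add: algebra_simps)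
      qed
      finally show ?thesis .
    qed
    have "(\<integral>t. hoeffding_term f U (x(i := t)) \<partial>M i) = (-1) ^ card U *
        (\<Sum>W\<in>Pow (U - {i}). (-1) ^ card W *
          (marginal f W (restrict x W) - (\<integral>t. ?m (insert i W) t \<partial>M i)))"
      using elim unfolding hoeffding_term_def split
      by (simp add: Bochner_Integration.integral_sum M.prob_space)
    also have "\<dots> = 0"
      using elim by simp
    finally show ?case .
  qed
qed

lemma sobol_hoeffding_decomposition_hoeffding_term:
  assumes "finite_product_prob_space \<mu> {1..d}" and f: "square_integrable (PiM {1..d} \<mu>) f"
  shows "sobol_hoeffding_decomposition d \<mu> f (finite_product_prob_space.hoeffding_term \<mu> {1..d} f)"
proof -
  interpret finite_product_prob_space \<mu> "{1..d}" by fact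
  show ?thesis
    unfolding sobol_hoeffding_decomposition_def
    by (intro conjI allI impI ballI square_integrable_hoeffding_term integral_hoeffding_term f
        hoeffding_term_empty AE_I2 sum_hoeffding_term[symmetric])
qed

lemma sobol_hoeffding_decomposition_sobol_term:
  assumes "finite_product_prob_space \<mu> {1..d}" "square_integrable (PiM {1..d} \<mu>) f"
  shows "sobol_hoeffding_decomposition d \<mu> f (sobol_term d \<mu> f)"
  unfolding sobol_term_def
  using sobol_hoeffding_decomposition_hoeffding_term[OF assms] by (rule someI[where P = "sobol_hoeffding_decomposition d \<mu> f"])

lemma square_integrable_decomposition_term:
  assumes "finite_product_prob_space \<mu> {1..d}"
    and F: "sobol_hoeffding_decomposition d \<mu> f F" and U: "U \<subseteq> {1..d}"
  shows "square_integrable (PiM {1..d} \<mu>) (\<lambda>x. F U (restrict x U))"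
proof -
  interpret finite_product_prob_space \<mu> "{1..d}" by fact
  show ?thesis
    using F U by (intro square_integrable_restrict) (auto simp: sobol_hoeffding_decomposition_def)
qed

section \<open>Orthogonality of the terms and the variance\<close>

lemma decomposition_terms_orthogonal:
  assumes "finite_product_prob_space \<mu> {1..d}"
    and F: "sobol_hoeffding_decomposition d \<mu> f F" and G: "sobol_hoeffding_decomposition d \<mu> g G"
    and UV: "U \<subseteq> {1..d}" "V \<subseteq> {1..d}" "U \<noteq> V"
  shows "(\<integral>x. F U (restrict x U) * G V (restrict x V) \<partial>PiM {1..d} \<mu>) = 0"
proof -
  interpret finite_product_prob_space \<mu> "{1..d}" by fact
  have sq: "square_integrable (PiM U \<mu>) (F U)" "square_integrable (PiM V \<mu>) (G V)"
    using F G UV by (auto simp: sobol_hoeffding_decomposition_def)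
  consider i where "i \<in> U" "i \<notin> V" | i where "i \<in> V" "i \<notin> U"
    using UV by blast
  then show ?thesis
  proof cases
    case 1
    then have "AE x in PiM U \<mu>. (\<integral>t. F U (x(i := t)) \<partial>\<mu> i) = 0"
      using F UV by (auto simp: sobol_hoeffding_decomposition_def)
    then show ?thesis
      by (rule integral_mult_terms_eq_0[OF UV(1,2) 1 sq])
  next
    case 2
    then have "AE x in PiM V \<mu>. (\<integral>t. G V (x(i := t)) \<partial>\<mu> i) = 0"
      using G UV by (auto simp: sobol_hoeffding_decomposition_def)
    then have "(\<integral>x. G V (restrict x V) * F U (restrict x U) \<partial>PiM {1..d} \<mu>) = 0"
      by (rule integral_mult_terms_eq_0[OF UV(2,1) 2 sq(2,1)])
    then show ?thesis by (simp add: mult.commute)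
  qed
qed

lemma integral_decomposition_term_eq_0:
  assumes "finite_product_prob_space \<mu> {1..d}"
    and F: "sobol_hoeffding_decomposition d \<mu> f F" and U: "U \<subseteq> {1..d}" "U \<noteq> {}"
  shows "(\<integral>x. F U (restrict x U) \<partial>PiM {1..d} \<mu>) = 0"
proof -
  interpret finite_product_prob_space \<mu> "{1..d}" by fact
  obtain i where i: "i \<in> U" using U by auto
  have sq: "square_integrable (PiM U \<mu>) (F U)"
    and van: "AE x in PiM U \<mu>. (\<integral>t. F U (x(i := t)) \<partial>\<mu> i) = 0"
    using F U i by (auto simp: sobol_hoeffding_decomposition_def)
  \<comment> \<open>The integral is the scalar product with the constant 1, a function of no coordinates.\<close>
  have "prob_space (PiM {} \<mu>)" by (rule prob_space_PiM) simp
  then interpret E: prob_space "PiM {} \<mu>" .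
  have "square_integrable (PiM {} \<mu>) (\<lambda>_. 1)" by (simp add: square_integrable_def)
  from integral_mult_terms_eq_0[OF U(1) empty_subsetI i _ sq this van]
  show ?thesis by (simp only: mult_1_right empty_iff not_False_eq_True True_implies_equals)
qed

lemma variance_decomposition:
  assumes fp: "finite_product_prob_space \<mu> {1..d}" and f: "square_integrable (PiM {1..d} \<mu>) f"
    and F: "sobol_hoeffding_decomposition d \<mu> f F"
  shows "prob_space.variance (PiM {1..d} \<mu>) f =
    (\<Sum>U\<in>Pow {1..d} - {{}}. \<integral>x. (F U (restrict x U))\<^sup>2 \<partial>PiM {1..d} \<mu>)"
proof -
  let ?P = "PiM {1..d} \<mu>" and ?N = "Pow {1..d} - {{}} :: nat set set"
  note sq = square_integrable_decomposition_term[OF fp F]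
  have F0: "F {} (restrict x {}) = (\<integral>x. f x \<partial>?P)" for x
    using F by (simp add: sobol_hoeffding_decomposition_def restrict_def)
  have "AE x in ?P. f x = (\<Sum>U\<in>Pow {1..d}. F U (restrict x U))"
    using F by (simp add: sobol_hoeffding_decomposition_def)
  then have "AE x in ?P. (f x - (\<integral>x. f x \<partial>?P))\<^sup>2 = (\<Sum>U\<in>?N. F U (restrict x U))\<^sup>2"
  proof eventually_elim
    case (elim x)
    have "(\<Sum>U\<in>Pow {1..d}. F U (restrict x U))
        = F {} (restrict x {}) + (\<Sum>U\<in>?N. F U (restrict x U))"
      by (rule sum.remove) auto
    then show ?case using elim by (simp add: F0)
  qed
  moreover have "(\<lambda>x. (f x - (\<integral>x. f x \<partial>?P))\<^sup>2) \<in> borel_measurable ?P"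
    using square_integrableD(1)[OF f] by measurable
  moreover have "(\<lambda>x. (\<Sum>U\<in>?N. F U (restrict x U))\<^sup>2) \<in> borel_measurable ?P"
    using sq by (intro borel_measurable_power borel_measurable_sum square_integrableD(1)) auto
  ultimately have "prob_space.variance ?P f = (\<integral>x. (\<Sum>U\<in>?N. F U (restrict x U))\<^sup>2 \<partial>?P)"
    by (intro integral_cong_AE)
  also have "\<dots> = (\<Sum>U\<in>?N. \<integral>x. (F U (restrict x U))\<^sup>2 \<partial>?P)"
    using sq decomposition_terms_orthogonal[OF fp F F]
    by (intro integral_square_sum_orthogonal) auto
  finally show ?thesis .
qed

text \<open>
  This is Pythagoras' theorem for \<open>f - g\<close>; the orthogonality of the differences of terms follows
  from that of all four pairs of terms of \<open>f\<close> and \<open>g\<close>, without any uniqueness of decompositions.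
\<close>

lemma integral_square_diff_decomposition:
  assumes fp: "finite_product_prob_space \<mu> {1..d}"
    and f: "square_integrable (PiM {1..d} \<mu>) f" and g: "square_integrable (PiM {1..d} \<mu>) g"
    and F: "sobol_hoeffding_decomposition d \<mu> f F" and G: "sobol_hoeffding_decomposition d \<mu> g G"
  shows "(\<integral>x. (f x - g x)\<^sup>2 \<partial>PiM {1..d} \<mu>) =
    (\<Sum>U\<in>Pow {1..d}. \<integral>x. (F U (restrict x U) - G U (restrict x U))\<^sup>2 \<partial>PiM {1..d} \<mu>)"
proof -
  let ?P = "PiM {1..d} \<mu>"
  let ?h = "\<lambda>U x. F U (restrict x U) - G U (restrict x U)"
  note sqF = square_integrable_decomposition_term[OF fp F]
    and sqG = square_integrable_decomposition_term[OF fp G]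
  have sq: "square_integrable ?P (?h U)" if "U \<subseteq> {1..d}" for U
    using sqF[OF that] sqG[OF that] by (rule square_integrable_diff)
  have "AE x in ?P. f x = (\<Sum>U\<in>Pow {1..d}. F U (restrict x U))"
    "AE x in ?P. g x = (\<Sum>U\<in>Pow {1..d}. G U (restrict x U))"
    using F G by (simp_all add: sobol_hoeffding_decomposition_def)
  then have "AE x in ?P. (f x - g x)\<^sup>2 = (\<Sum>U\<in>Pow {1..d}. ?h U x)\<^sup>2"
    by eventually_elim (simp add: sum_subtractf)
  moreover have "(\<lambda>x. (f x - g x)\<^sup>2) \<in> borel_measurable ?P"
    using square_integrableD(1)[OF f] square_integrableD(1)[OF g] by measurable
  moreover have "(\<lambda>x. (\<Sum>U\<in>Pow {1..d}. ?h U x)\<^sup>2) \<in> borel_measurable ?P"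
    using sq by (intro borel_measurable_power borel_measurable_sum square_integrableD(1)) auto
  ultimately have "(\<integral>x. (f x - g x)\<^sup>2 \<partial>?P) = (\<integral>x. (\<Sum>U\<in>Pow {1..d}. ?h U x)\<^sup>2 \<partial>?P)"
    by (intro integral_cong_AE)
  also have "\<dots> = (\<Sum>U\<in>Pow {1..d}. \<integral>x. (?h U x)\<^sup>2 \<partial>?P)"
  proof (rule integral_square_sum_orthogonal)
    fix U V assume UV: "U \<in> Pow {1..d}" "V \<in> Pow {1..d}" "U \<noteq> V"
    then have UV': "U \<subseteq> {1..d}" "V \<subseteq> {1..d}" by auto
    note int = square_integrable_imp_integrable_mult[OF sqF[OF UV'(1)] sqF[OF UV'(2)]]
      square_integrable_imp_integrable_mult[OF sqF[OF UV'(1)] sqG[OF UV'(2)]]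
      square_integrable_imp_integrable_mult[OF sqG[OF UV'(1)] sqF[OF UV'(2)]]
      square_integrable_imp_integrable_mult[OF sqG[OF UV'(1)] sqG[OF UV'(2)]]
    note orth = decomposition_terms_orthogonal[OF fp F F UV' UV(3)]
      decomposition_terms_orthogonal[OF fp F G UV' UV(3)]
      decomposition_terms_orthogonal[OF fp G F UV' UV(3)]
      decomposition_terms_orthogonal[OF fp G G UV' UV(3)]
    have "(\<integral>x. ?h U x * ?h V x \<partial>?P) =
      (\<integral>x. (F U (restrict x U) * F V (restrict x V) - F U (restrict x U) * G V (restrict x V))
        - (G U (restrict x U) * F V (restrict x V) - G U (restrict x U) * G V (restrict x V)) \<partial>?P)"
      by (simp add: algebra_simps)
    also have "\<dots> = 0"
      using int by (simp add: orth del: One_nat_def)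
    finally show "(\<integral>x. ?h U x * ?h V x \<partial>?P) = 0" .
  qed (use sq in auto)
  finally show ?thesis .
qed

section \<open>Sobol' indices\<close>

lemma sobol_index_empty:
  assumes fp: "finite_product_prob_space \<mu> {1..d}"
  shows "sobol_index d \<mu> f {} = 0"
proof -
  interpret finite_product_prob_space \<mu> "{1..d}" by fact
  have const: "restrict x {} = (\<lambda>_. undefined)" for x :: "nat \<Rightarrow> real"
    by (simp add: restrict_def)
  show ?thesis
    unfolding sobol_index_def const by (simp add: P.prob_space del: One_nat_def)
qed

lemma sobol_index_eq_L2_norm:
  assumes fp: "finite_product_prob_space \<mu> {1..d}" and f: "square_integrable (PiM {1..d} \<mu>) f"
    and U: "U \<subseteq> {1..d}" "U \<noteq> {}"
  shows "sobol_index d \<mu> f U =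
    (L2_norm (PiM {1..d} \<mu>) (\<lambda>x. sobol_term d \<mu> f U (restrict x U)))\<^sup>2 /
    prob_space.variance (PiM {1..d} \<mu>) f"
  using integral_decomposition_term_eq_0[OF fp sobol_hoeffding_decomposition_sobol_term[OF fp f] U]
  by (simp add: sobol_index_def L2_norm_def)

text \<open>
  Sobol' indices and total-effect indices are both sums of Sobol' indices over a family \<open>A\<close> of
  nonempty sets, so this covers the two cases at once.
\<close>

lemma sobol_index_sum_diff_le:
  assumes fp: "finite_product_prob_space \<mu> {1..d}"
    and f: "square_integrable (PiM {1..d} \<mu>) f" and g: "square_integrable (PiM {1..d} \<mu>) g"
    and Vf: "prob_space.variance (PiM {1..d} \<mu>) f > 0"
    and Vg: "prob_space.variance (PiM {1..d} \<mu>) g > 0"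
    and A: "A \<subseteq> Pow {1..d} - {{}}"
    and s: "s = (\<Sum>U\<in>A. sobol_index d \<mu> f U)" and t: "t = (\<Sum>U\<in>A. sobol_index d \<mu> g U)"
    and e: "e = L2_norm (PiM {1..d} \<mu>) (\<lambda>x. f x - g x) / sqrt (prob_space.variance (PiM {1..d} \<mu>) f)"
  shows "\<bar>s - t\<bar> \<le> (sqrt (s * (1 - t)) + sqrt (t * (1 - s))) * e" "\<bar>s - t\<bar> \<le> e"
proof -
  let ?P = "PiM {1..d} \<mu>" and ?N = "Pow {1..d} - {{}} :: nat set set"
  let ?F = "sobol_term d \<mu> f" and ?G = "sobol_term d \<mu> g"
  define p where "p U = L2_norm ?P (\<lambda>x. ?F U (restrict x U))" for U
  define q where "q U = L2_norm ?P (\<lambda>x. ?G U (restrict x U))" for U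
  note F = sobol_hoeffding_decomposition_sobol_term[OF fp f]
    and G = sobol_hoeffding_decomposition_sobol_term[OF fp g]
  have V: "prob_space.variance ?P f = (\<Sum>U\<in>?N. (p U)\<^sup>2)"
    "prob_space.variance ?P g = (\<Sum>U\<in>?N. (q U)\<^sup>2)"
    using variance_decomposition[OF fp f F] variance_decomposition[OF fp g G]
    by (simp_all add: p_def q_def L2_norm_def)
  have "(\<Sum>U\<in>?N. (p U - q U)\<^sup>2) \<le>
      (\<Sum>U\<in>?N. \<integral>x. (?F U (restrict x U) - ?G U (restrict x U))\<^sup>2 \<partial>?P)"
    unfolding p_def q_def
    by (intro sum_mono L2_norm_diff_le square_integrable_decomposition_term[OF fp F]
        square_integrable_decomposition_term[OF fp G]) auto
  also have "\<dots> \<le> (\<Sum>U\<in>Pow {1..d}. \<integral>x. (?F U (restrict x U) - ?G U (restrict x U))\<^sup>2 \<partial>?P)"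
    by (intro sum_mono2) auto
  also have "\<dots> = (\<integral>x. (f x - g x)\<^sup>2 \<partial>?P)"
    by (rule integral_square_diff_decomposition[OF fp f g F G, symmetric])
  also have "\<dots> = e\<^sup>2 * prob_space.variance ?P f"
    using Vf by (simp add: e L2_norm_def power_divide)
  finally have dist: "(\<Sum>U\<in>?N. (p U - q U)\<^sup>2) \<le> e\<^sup>2 * prob_space.variance ?P f" .
  have e0: "e \<ge> 0" using Vf by (simp add: e L2_norm_def)
  have sA: "s = (\<Sum>U\<in>A. (p U)\<^sup>2) / prob_space.variance ?P f"
    unfolding s sum_divide_distrib
  proof (intro sum.cong refl)
    fix U assume "U \<in> A"
    then show "sobol_index d \<mu> f U = (p U)\<^sup>2 / prob_space.variance ?P f"
      using A unfolding p_def by (intro sobol_index_eq_L2_norm[OF fp f]) auto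
  qed
  have tA: "t = (\<Sum>U\<in>A. (q U)\<^sup>2) / prob_space.variance ?P g"
    unfolding t sum_divide_distrib
  proof (intro sum.cong refl)
    fix U assume "U \<in> A"
    then show "sobol_index d \<mu> g U = (q U)\<^sup>2 / prob_space.variance ?P g"
      using A unfolding q_def by (intro sobol_index_eq_L2_norm[OF fp g]) auto
  qed
  have fin: "finite ?N" by simp
  note * = variance_share_diff_le[OF fin A V(1) Vf V(2) Vg dist e0 sA tA]
  show "\<bar>s - t\<bar> \<le> (sqrt (s * (1 - t)) + sqrt (t * (1 - s))) * e" "\<bar>s - t\<bar> \<le> e"
    by (fact *)+
qed

text \<open>
  The locale of product probability spaces asks for a probability measure at every index. The
  measures outside of the index set are replaced by point masses, which affects neither the product
  measures nor the indices.
\<close>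

lemma finite_product_prob_space_extend:
  assumes "finite I" "\<And>i. i \<in> I \<Longrightarrow> prob_space (M i)"
  shows "finite_product_prob_space (\<lambda>i. if i \<in> I then M i else count_space {undefined}) I"
proof -
  interpret prob_space "if i \<in> I then M i else count_space {undefined}" for i
    using assms(2) by (cases "i \<in> I") (auto intro!: prob_spaceI)
  show ?thesis by unfold_locales fact
qed

lemma PiM_extend:
  assumes "U \<subseteq> I"
  shows "PiM U (\<lambda>i. if i \<in> I then M i else N i) = PiM U M"
  using assms by (intro PiM_cong) auto

lemma sobol_hoeffding_decomposition_extend:
  "sobol_hoeffding_decomposition d (\<lambda>i. if i \<in> {1..d} then \<mu> i else \<nu> i) f F
    \<longleftrightarrow> sobol_hoeffding_decomposition d \<mu> f F"
proof -
  have *: "(if i \<in> {1..d} then \<mu> i else \<nu> i) = \<mu> i" if "U \<subseteq> {1..d}" "i \<in> U" for U i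
    using that by auto
  show ?thesis
    unfolding sobol_hoeffding_decomposition_def
    by (simp add: PiM_extend * cong: imp_cong ball_cong cong del: AE_cong
        del: atLeastAtMost_iff One_nat_def)
qed

lemma sobol_index_extend:
  "sobol_index d (\<lambda>i. if i \<in> {1..d} then \<mu> i else \<nu> i) f U = sobol_index d \<mu> f U"
proof -
  have "sobol_hoeffding_decomposition d (\<lambda>i. if i \<in> {1..d} then \<mu> i else \<nu> i) f
      = sobol_hoeffding_decomposition d \<mu> f"
    by (intro ext sobol_hoeffding_decomposition_extend)
  then show ?thesis
    unfolding sobol_index_def sobol_term_def by (simp only: PiM_extend[OF order_refl])
qed

theorem theorem1:
  fixes d :: nat
    and X :: "nat \<Rightarrow> real set"
    and \<mu> :: "nat \<Rightarrow> real measure"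
    and f f' :: "(nat \<Rightarrow> real) \<Rightarrow> real"
    and S S' :: "nat set \<Rightarrow> real"
    and \<E> :: real
  assumes "\<And>i. i \<in> {1..d} \<Longrightarrow> sets (\<mu> i) = sets (restrict_space borel (X i))"
    and "\<And>i. i \<in> {1..d} \<Longrightarrow> prob_space (\<mu> i)"
    and "square_integrable (PiM {1..d} \<mu>) f"
    and "square_integrable (PiM {1..d} \<mu>) f'"
    and "prob_space.variance (PiM {1..d} \<mu>) f > 0"
    and "prob_space.variance (PiM {1..d} \<mu>) f' > 0"
    and "\<E> = L2_norm (PiM {1..d} \<mu>) (\<lambda>x. f x - f' x) / sqrt (prob_space.variance (PiM {1..d} \<mu>) f)"
    and "(S = sobol_index d \<mu> f \<and> S' = sobol_index d \<mu> f') \<or>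
         (S = total_index d \<mu> f \<and> S' = total_index d \<mu> f')"
  shows "(\<forall>U\<subseteq>{1..d}. \<bar>S U - S' U\<bar> \<le> (sqrt (S U * (1 - S' U)) + sqrt (S' U * (1 - S U))) * \<E>) \<and>
         Max ((\<lambda>U. \<bar>S U - S' U\<bar>) ` Pow {1..d}) \<le> \<E>"
proof -
  define \<mu>' where "\<mu>' = (\<lambda>i. if i \<in> {1..d} then \<mu> i else count_space {undefined})"
  have fp: "finite_product_prob_space \<mu>' {1..d}"
    unfolding \<mu>'_def using assms(2) by (intro finite_product_prob_space_extend) auto
  have P: "PiM {1..d} \<mu> = PiM {1..d} \<mu>'"
    unfolding \<mu>'_def by (rule PiM_extend[OF order_refl, symmetric])
  have idx: "sobol_index d \<mu> h V = sobol_index d \<mu>' h V" for h V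
    unfolding \<mu>'_def by (rule sobol_index_extend[symmetric])
  have shares: "\<exists>A\<subseteq>Pow {1..d} - {{}}. S U = (\<Sum>V\<in>A. sobol_index d \<mu>' f V) \<and>
      S' U = (\<Sum>V\<in>A. sobol_index d \<mu>' f' V)" if U: "U \<subseteq> {1..d}" for U
    using assms(8)
  proof
    assume S: "S = sobol_index d \<mu> f \<and> S' = sobol_index d \<mu> f'"
    \<comment> \<open>For \<open>U = {}\<close> the family is empty, and the index is 0.\<close>
    show ?thesis
      using U
      by (intro exI[of _ "{U} - {{}}"]) (cases "U = {}"; auto simp: S idx sobol_index_empty[OF fp])
  next
    assume S: "S = total_index d \<mu> f \<and> S' = total_index d \<mu> f'"
    show ?thesis
      by (intro exI[of _ "{V. V \<subseteq> {1..d} \<and> V \<inter> U \<noteq> {}}"]) (auto simp: S total_index_def idx)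
  qed
  have bounds: "\<bar>S U - S' U\<bar> \<le> (sqrt (S U * (1 - S' U)) + sqrt (S' U * (1 - S U))) * \<E>"
    "\<bar>S U - S' U\<bar> \<le> \<E>" if U: "U \<subseteq> {1..d}" for U
  proof -
    obtain A where A: "A \<subseteq> Pow {1..d} - {{}}" "S U = (\<Sum>V\<in>A. sobol_index d \<mu>' f V)"
      "S' U = (\<Sum>V\<in>A. sobol_index d \<mu>' f' V)"
      using shares[OF U] by blast
    note * = sobol_index_sum_diff_le[OF fp assms(3-6)[unfolded P] A assms(7)[unfolded P]]
    show "\<bar>S U - S' U\<bar> \<le> (sqrt (S U * (1 - S' U)) + sqrt (S' U * (1 - S U))) * \<E>"
      "\<bar>S U - S' U\<bar> \<le> \<E>"
      by (fact *)+
  qed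
  then show ?thesis by (intro conjI allI impI Max.boundedI) auto
qed

end
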